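(* Consider the Gaussian sequence model $X_i\sim\mathcal N(\theta_i,1)$, $i=1,\dots,n$, independent, with parameter space $\Theta(s)$ and sparsity $s=s_n\ll\sqrt n$. Any estimator $\widehat\theta$ that attains the minimax estimation rate $s\log(n)$ with respect to the worst case risk $\sup_{\theta\in\Theta(s)}E_\theta[\|\widehat\theta-\theta\|_2^2]$ also satisfies, for all sufficiently large $n$, $$\sup_{\theta\in\Theta(s)}\big\|E_\theta[\widehat\theta]-\theta\big\|_2^2\asymp s\log(n)\qquad\text{and}\qquad\sup_{\theta\in\Theta(s)}\sum_{i=1}^n\mathrm{Var}_\theta(\widehat\theta_i)\ge\frac s2.$$ Moreover, if $s\le n^{1/2-\delta}$ for some $0<\delta<1/2$, then there exists an estimator attaining the minimax estimation rate with $\sup_{\theta\in\Theta(s)}\sum_{i=1}^n\mathrm{Var}_\theta(\widehat\theta_i)\lesssim s$.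
   Context: $\Theta(s)$ is the set of all vectors $\theta=(\theta_1,\dots,\theta_n)\in\mathbb R^n$ with at most $s$ non-zero components, where $s=s_n\geq 1$ is a sequence of integers; $s\ll\sqrt n$ means $s_n/\sqrt n\to0$ as $n\to\infty$. "Estimator" means a sequence (in $n$) of measurable functions $\widehat\theta=(\widehat\theta_1,\dots,\widehat\theta_n)$ of $X=(X_1,\dots,X_n)$ with values in $\mathbb R^n$ (not required to be sparse) having finite expectation for all parameters. Attaining the rate $s\log(n)$ means $\sup_{\theta\in\Theta(s)}E_\theta[\|\widehat\theta-\theta\|_2^2]\le C s\log(n)$ for a constant $C$ not depending on $n$ and all sufficiently large $n$. $a_n\lesssim b_n$ means $a_n\le C b_n$ for a constant $C$ and all sufficiently large $n$; $a_n\asymp b_n$ means $a_n\lesssim b_n$ and $b_n\lesssim a_n$. $\|\cdot\|_2$ is the Euclidean norm. *)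

theory Defs
  imports "HOL-Probability.Probability"
begin

text \<open>
  Vectors of length \<open>n\<close> are extensional functions on \<open>{1..n}\<close>, so that the dimension can vary
  within one statement.  Suprema and second moments are taken in \<^typ>\<open>ennreal\<close>, where an
  unbounded family or a divergent integral has value \<open>\<infinity>\<close>.
\<close>

definition sparse_vectors :: "nat \<Rightarrow> nat \<Rightarrow> (nat \<Rightarrow> real) set" where
  "sparse_vectors n k =
     {\<theta> \<in> {1..n} \<rightarrow>\<^sub>E UNIV. card {i \<in> {1..n}. \<theta> i \<noteq> 0} \<le> k}"

definition gauss_seq :: "nat \<Rightarrow> (nat \<Rightarrow> real) \<Rightarrow> (nat \<Rightarrow> real) measure" where
  "gauss_seq n \<theta> =
     (\<Pi>\<^sub>M i\<in>{1..n}. density lborel (\<lambda>x. ennreal (normal_density (\<theta> i) 1 x)))"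

text \<open>
  An estimator is a sequence in \<open>n\<close>.  The parameters for which its expectation has to be finite
  are those of the parameter space; its values need not be sparse.
\<close>

definition estimator ::
    "(nat \<Rightarrow> nat) \<Rightarrow> (nat \<Rightarrow> (nat \<Rightarrow> real) \<Rightarrow> (nat \<Rightarrow> real)) \<Rightarrow> bool" where
  "estimator s T \<longleftrightarrow> (\<forall>n\<ge>1.
     T n \<in> (\<Pi>\<^sub>M i\<in>{1..n}. borel) \<rightarrow>\<^sub>M (\<Pi>\<^sub>M i\<in>{1..n}. borel) \<and>
     (\<forall>\<theta>\<in>sparse_vectors n (s n). \<forall>i\<in>{1..n}. integrable (gauss_seq n \<theta>) (\<lambda>x. T n x i)))"

definition mean ::
    "nat \<Rightarrow> (nat \<Rightarrow> real) \<Rightarrow> ((nat \<Rightarrow> real) \<Rightarrow> (nat \<Rightarrow> real)) \<Rightarrow> nat \<Rightarrow> real" where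
  "mean n \<theta> t i = (\<integral>x. t x i \<partial>gauss_seq n \<theta>)"

definition risk ::
    "nat \<Rightarrow> (nat \<Rightarrow> real) \<Rightarrow> ((nat \<Rightarrow> real) \<Rightarrow> (nat \<Rightarrow> real)) \<Rightarrow> ennreal" where
  "risk n \<theta> t =
     (\<integral>\<^sup>+x. ennreal ((L2_set (\<lambda>i. t x i - \<theta> i) {1..n})\<^sup>2) \<partial>gauss_seq n \<theta>)"

definition sq_bias ::
    "nat \<Rightarrow> (nat \<Rightarrow> real) \<Rightarrow> ((nat \<Rightarrow> real) \<Rightarrow> (nat \<Rightarrow> real)) \<Rightarrow> ennreal" where
  "sq_bias n \<theta> t = ennreal ((L2_set (\<lambda>i. mean n \<theta> t i - \<theta> i) {1..n})\<^sup>2)"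

text \<open>
  The nonnegative integral is used because the Bochner integral would assign variance \<open>0\<close> to a
  component that is not square integrable.
\<close>

definition coord_var ::
    "nat \<Rightarrow> (nat \<Rightarrow> real) \<Rightarrow> ((nat \<Rightarrow> real) \<Rightarrow> (nat \<Rightarrow> real)) \<Rightarrow> nat \<Rightarrow> ennreal" where
  "coord_var n \<theta> t i = (\<integral>\<^sup>+x. ennreal ((t x i - mean n \<theta> t i)\<^sup>2) \<partial>gauss_seq n \<theta>)"

definition worst_risk ::
    "(nat \<Rightarrow> nat) \<Rightarrow> (nat \<Rightarrow> (nat \<Rightarrow> real) \<Rightarrow> (nat \<Rightarrow> real)) \<Rightarrow> nat \<Rightarrow> ennreal" where
  "worst_risk s T n = (SUP \<theta>\<in>sparse_vectors n (s n). risk n \<theta> (T n))"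

definition worst_sq_bias ::
    "(nat \<Rightarrow> nat) \<Rightarrow> (nat \<Rightarrow> (nat \<Rightarrow> real) \<Rightarrow> (nat \<Rightarrow> real)) \<Rightarrow> nat \<Rightarrow> ennreal" where
  "worst_sq_bias s T n = (SUP \<theta>\<in>sparse_vectors n (s n). sq_bias n \<theta> (T n))"

definition worst_var ::
    "(nat \<Rightarrow> nat) \<Rightarrow> (nat \<Rightarrow> (nat \<Rightarrow> real) \<Rightarrow> (nat \<Rightarrow> real)) \<Rightarrow> nat \<Rightarrow> ennreal" where
  "worst_var s T n =
     (SUP \<theta>\<in>sparse_vectors n (s n). \<Sum>i\<in>{1..n}. coord_var n \<theta> (T n) i)"

text \<open>The library's Landau symbols do not apply to \<^typ>\<open>ennreal\<close>-valued sequences.\<close>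

definition lesssim :: "(nat \<Rightarrow> ennreal) \<Rightarrow> (nat \<Rightarrow> ennreal) \<Rightarrow> bool" where
  "lesssim a b \<longleftrightarrow> (\<exists>C::real. C > 0 \<and> (\<forall>\<^sub>F n in sequentially. a n \<le> ennreal C * b n))"

definition same_order :: "(nat \<Rightarrow> ennreal) \<Rightarrow> (nat \<Rightarrow> ennreal) \<Rightarrow> bool" where
  "same_order a b \<longleftrightarrow> lesssim a b \<and> lesssim b a"

definition sparse_rate :: "(nat \<Rightarrow> nat) \<Rightarrow> nat \<Rightarrow> ennreal" where
  "sparse_rate s n = ennreal (real (s n) * ln (real n))"

definition attains_rate ::
    "(nat \<Rightarrow> nat) \<Rightarrow> (nat \<Rightarrow> (nat \<Rightarrow> real) \<Rightarrow> (nat \<Rightarrow> real)) \<Rightarrow> bool" where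
  "attains_rate s T \<longleftrightarrow> lesssim (worst_risk s T) (sparse_rate s)"

end

theory Submission
  imports Defs
begin

text \<open>
  Both lower bounds rest on the Hammersley-Chapman-Robbins inequality: moving the parameter from
  \<open>\<theta>\<close> to \<open>\<eta>\<close> changes the mean of a statistic \<open>f\<close> by at most
  \<open>(Var\<^sub>\<theta> f \<cdot> (exp(\<bar>\<eta> - \<theta>\<bar>\<^sup>2) - 1))\<^sup>1\<^sup>/\<^sup>2\<close>.

  Variance at least \<open>s/2\<close>: since the bias is bounded for fixed \<open>n\<close>, the mean of the \<open>i\<close>-th
  component has average slope close to \<open>1\<close> along a long segment in direction \<open>i\<close>.  With unit steps
  the average variance along the segment is at least about \<open>1/(e - 1) > 1/2\<close>.  Averaging over a large
  grid in the first \<open>s\<close> coordinates treats all \<open>s\<close> directions at the same parameter points.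

  Bias of order \<open>s log n\<close>: split \<open>s N \<le> n\<close> coordinates into \<open>s\<close> blocks of length \<open>N \<ge> \<surd>n\<close> and
  put one spike of height \<open>\<mu>\<close>, where \<open>\<mu>\<^sup>2 = log(n)/16\<close>, at a uniformly random place of every block.
  With small bias, moving one spike changes the mean of the affected components by about \<open>\<mu>\<close>, which
  forces variance of order \<open>exp(- 2\<mu>\<^sup>2) \<mu>\<^sup>2\<close> in each of the \<open>N\<close> components of each block.
  The total exceeds every multiple of \<open>s log n\<close>.  Working blockwise is what allows
  \<open>s\<close> arbitrarily close to \<open>\<surd>n\<close>: comparing with the null vector would only give \<open>s log(n/s\<^sup>2)\<close>.

  Soft thresholding at \<open>(2 log n)\<^sup>1\<^sup>/\<^sup>2\<close> has variance of order \<open>s\<close>: it is a contraction, so every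
  component has variance at most \<open>1\<close>, and the null components contribute \<open>O(1/n)\<close> each.
\<close>

subsection \<open>Change of measure in the Gaussian sequence model\<close>

abbreviation gauss :: "real \<Rightarrow> real measure" where
  "gauss a \<equiv> density lborel (\<lambda>x. ennreal (normal_density a 1 x))"

text \<open>The density of \<open>gauss b\<close> with respect to \<open>gauss a\<close>, in
  exponential form centred at \<open>a\<close>.\<close>

definition gauss_ratio :: "real \<Rightarrow> real \<Rightarrow> real \<Rightarrow> real" where
  "gauss_ratio a b x = exp ((b - a) * (x - a) - (b - a)\<^sup>2 / 2)"

lemma gauss_ratio_nonneg [simp]: "0 \<le> gauss_ratio a b x"
  by (simp add: gauss_ratio_def)

lemma borel_measurable_gauss_ratio [measurable]: "gauss_ratio a b \<in> borel_measurable borel"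
  unfolding gauss_ratio_def by measurable

lemma prob_space_gauss: "prob_space (gauss a)"
  by (rule prob_space_normal_density) simp

lemma normal_density_shift:
  "normal_density a 1 x * gauss_ratio a b x = normal_density b 1 x"
proof -
  have "- (x - a)\<^sup>2 / 2 + ((b - a) * (x - a) - (b - a)\<^sup>2 / 2) = - (x - b)\<^sup>2 / 2"
    by (simp add: power2_eq_square field_simps)
  then show ?thesis
    by (simp add: normal_density_def gauss_ratio_def flip: exp_add)
qed

text \<open>Completing the square: the squared ratio tilts \<open>gauss a\<close> twice as far, to
  centre \<open>2 * b - a\<close>, and leaves a constant factor. This gives the second moment of the
  ratio in closed form.\<close>

lemma normal_density_gauss_ratio_sq:
  "normal_density a 1 x * (gauss_ratio a b x)\<^sup>2 = exp ((b - a)\<^sup>2) * normal_density (2 * b - a) 1 x"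
proof -
  have "- (x - a)\<^sup>2 / 2 + 2 * ((b - a) * (x - a) - (b - a)\<^sup>2 / 2)
      = (b - a)\<^sup>2 - (x - (2 * b - a))\<^sup>2 / 2"
    by (simp add: power2_eq_square field_simps)
  then show ?thesis
    by (simp add: normal_density_def gauss_ratio_def flip: exp_add exp_double)
qed

lemma nn_integral_normal_density: "(\<integral>\<^sup>+x. ennreal (normal_density a 1 x) \<partial>lborel) = 1"
  using prob_space.emeasure_space_1[OF prob_space_gauss[of a]] by (simp add: emeasure_density)

lemma density_gauss_ratio: "density (gauss a) (\<lambda>x. ennreal (gauss_ratio a b x)) = gauss b"
  by (subst density_density_eq) (simp_all add: normal_density_shift flip: ennreal_mult)

lemma nn_integral_gauss_ratio_sq:
  "(\<integral>\<^sup>+x. ennreal ((gauss_ratio a b x)\<^sup>2) \<partial>gauss a) = ennreal (exp ((b - a)\<^sup>2))"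
proof -
  have "ennreal (normal_density a 1 x) * ennreal ((gauss_ratio a b x)\<^sup>2)
      = ennreal (exp ((b - a)\<^sup>2)) * ennreal (normal_density (2 * b - a) 1 x)" for x
    by (simp add: normal_density_gauss_ratio_sq flip: ennreal_mult)
  then show ?thesis
    by (simp add: nn_integral_density nn_integral_cmult nn_integral_normal_density)
qed

section \<open>Likelihood ratios and chi-square divergence in the product model\<close>

lemma prob_space_gauss_seq: "prob_space (gauss_seq n \<theta>)"
  unfolding gauss_seq_def by (intro prob_space_PiM prob_space_gauss)

lemma sets_gauss_seq [measurable_cong]: "sets (gauss_seq n \<theta>) = sets (\<Pi>\<^sub>M i\<in>{1..n}. borel)"
  unfolding gauss_seq_def by (intro sets_PiM_cong) auto

definition seq_ratio :: "nat \<Rightarrow> (nat \<Rightarrow> real) \<Rightarrow> (nat \<Rightarrow> real) \<Rightarrow> (nat \<Rightarrow> real) \<Rightarrow> real" where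
  "seq_ratio n \<theta> \<eta> x = (\<Prod>i\<in>{1..n}. gauss_ratio (\<theta> i) (\<eta> i) (x i))"

lemma seq_ratio_nonneg [simp]: "0 \<le> seq_ratio n \<theta> \<eta> x"
  by (simp add: seq_ratio_def prod_nonneg)

lemma borel_measurable_seq_ratio [measurable]:
  "seq_ratio n \<theta> \<eta> \<in> borel_measurable (\<Pi>\<^sub>M i\<in>{1..n}. borel)"
  unfolding seq_ratio_def by measurable

text \<open>The product measure is characterised by its values on rectangles. There both the ratio
  and the indicator factor over the coordinates, and \<open>density_gauss_ratio\<close> settles each
  factor.\<close>

lemma density_seq_ratio:
  "density (gauss_seq n \<theta>) (\<lambda>x. ennreal (seq_ratio n \<theta> \<eta> x)) = gauss_seq n \<eta>"
proof -
  interpret G: product_sigma_finite "\<lambda>i. gauss (\<theta> i)"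
    by (intro product_sigma_finite.intro prob_space_imp_sigma_finite prob_space_gauss)
  interpret H: product_sigma_finite "\<lambda>i. gauss (\<eta> i)"
    by (intro product_sigma_finite.intro prob_space_imp_sigma_finite prob_space_gauss)
  show ?thesis
    unfolding gauss_seq_def[of n \<eta>]
  proof (rule H.PiM_eqI)
    fix A assume A: "\<And>i. i \<in> {1..n} \<Longrightarrow> A i \<in> sets (gauss (\<eta> i))"
    then have [measurable]: "\<And>i. i \<in> {1..n} \<Longrightarrow> A i \<in> sets borel" by simp
    have "emeasure (density (gauss_seq n \<theta>) (\<lambda>x. ennreal (seq_ratio n \<theta> \<eta> x))) (Pi\<^sub>E {1..n} A)
        = (\<integral>\<^sup>+x. ennreal (seq_ratio n \<theta> \<eta> x) * indicator (Pi\<^sub>E {1..n} A) x \<partial>gauss_seq n \<theta>)"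
      by (rule emeasure_density) (auto simp: sets_gauss_seq intro!: sets_PiM_I_finite)
    also have "\<dots> = (\<integral>\<^sup>+x. (\<Prod>i\<in>{1..n}. ennreal (gauss_ratio (\<theta> i) (\<eta> i) (x i)) * indicator (A i) (x i))
        \<partial>gauss_seq n \<theta>)"
    proof (rule nn_integral_cong)
      fix x assume "x \<in> space (gauss_seq n \<theta>)"
      \<comment> \<open>Extensionality makes membership in the rectangle a condition on the
        coordinates in \<open>{1..n}\<close> only.\<close>
      then have "x \<in> extensional {1..n}"
        by (auto simp: gauss_seq_def space_PiM PiE_def)
      then have "indicator (Pi\<^sub>E {1..n} A) x = (\<Prod>i\<in>{1..n}. indicator (A i) (x i) :: ennreal)"
        by (auto simp: indicator_def PiE_iff)
      then show "ennreal (seq_ratio n \<theta> \<eta> x) * indicator (Pi\<^sub>E {1..n} A) x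
          = (\<Prod>i\<in>{1..n}. ennreal (gauss_ratio (\<theta> i) (\<eta> i) (x i)) * indicator (A i) (x i))"
        by (simp add: seq_ratio_def prod.distrib prod_ennreal)
    qed
    also have "\<dots> = (\<Prod>i\<in>{1..n}. \<integral>\<^sup>+y. ennreal (gauss_ratio (\<theta> i) (\<eta> i) y) * indicator (A i) y
        \<partial>gauss (\<theta> i))"
      unfolding gauss_seq_def by (rule G.product_nn_integral_prod) auto
    also have "\<dots> = (\<Prod>i\<in>{1..n}. emeasure (density (gauss (\<theta> i)) (\<lambda>x. ennreal (gauss_ratio (\<theta> i) (\<eta> i) x))) (A i))"
      by (intro prod.cong refl emeasure_density[symmetric]) auto
    finally show "emeasure (density (gauss_seq n \<theta>) (\<lambda>x. ennreal (seq_ratio n \<theta> \<eta> x))) (Pi\<^sub>E {1..n} A)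
        = (\<Prod>i\<in>{1..n}. emeasure (gauss (\<eta> i)) (A i))"
      by (simp only: density_gauss_ratio)
  qed (simp_all add: gauss_seq_def cong: sets_PiM_cong)
qed

lemma nn_integral_seq_ratio_sq:
  "(\<integral>\<^sup>+x. ennreal ((seq_ratio n \<theta> \<eta> x)\<^sup>2) \<partial>gauss_seq n \<theta>)
     = ennreal (exp (\<Sum>i\<in>{1..n}. (\<eta> i - \<theta> i)\<^sup>2))"
proof -
  interpret G: product_sigma_finite "\<lambda>i. gauss (\<theta> i)"
    by (intro product_sigma_finite.intro prob_space_imp_sigma_finite prob_space_gauss)
  have "(\<integral>\<^sup>+x. ennreal ((seq_ratio n \<theta> \<eta> x)\<^sup>2) \<partial>gauss_seq n \<theta>)
     = (\<integral>\<^sup>+x. (\<Prod>i\<in>{1..n}. ennreal ((gauss_ratio (\<theta> i) (\<eta> i) (x i))\<^sup>2)) \<partial>gauss_seq n \<theta>)"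
    by (simp add: seq_ratio_def prod_ennreal flip: prod_power_distrib)
  also have "\<dots> = (\<Prod>i\<in>{1..n}. \<integral>\<^sup>+y. ennreal ((gauss_ratio (\<theta> i) (\<eta> i) y)\<^sup>2) \<partial>gauss (\<theta> i))"
    unfolding gauss_seq_def by (rule G.product_nn_integral_prod) auto
  finally show ?thesis
    by (simp add: nn_integral_gauss_ratio_sq prod_ennreal exp_sum)
qed

lemma nn_integral_seq_ratio: "(\<integral>\<^sup>+x. ennreal (seq_ratio n \<theta> \<eta> x) \<partial>gauss_seq n \<theta>) = 1"
proof -
  have "emeasure (density (gauss_seq n \<theta>) (\<lambda>x. ennreal (seq_ratio n \<theta> \<eta> x))) (space (gauss_seq n \<theta>)) = 1"
    using prob_space.emeasure_space_1[OF prob_space_gauss_seq[of n \<eta>]]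
    by (simp add: density_seq_ratio sets_eq_imp_space_eq[OF sets_gauss_seq])
  then show ?thesis
    by (subst (asm) emeasure_density) (auto cong: nn_integral_cong_simp)
qed

lemma integrable_seq_ratio: "integrable (gauss_seq n \<theta>) (seq_ratio n \<theta> \<eta>)"
  by (rule integrableI_bounded) (auto simp: nn_integral_seq_ratio)

lemma integrable_seq_ratio_sq: "integrable (gauss_seq n \<theta>) (\<lambda>x. (seq_ratio n \<theta> \<eta> x)\<^sup>2)"
  by (rule integrableI_bounded) (auto simp: nn_integral_seq_ratio_sq)

text \<open>The chi-square divergence of the two models: the ratio has mean 1, so expanding the
  square leaves its second moment minus 1.\<close>

lemma nn_integral_chi_square:
  "(\<integral>\<^sup>+x. ennreal ((seq_ratio n \<theta> \<eta> x - 1)\<^sup>2) \<partial>gauss_seq n \<theta>)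
     = ennreal (exp (\<Sum>i\<in>{1..n}. (\<eta> i - \<theta> i)\<^sup>2) - 1)"
proof -
  interpret prob_space "gauss_seq n \<theta>" by (rule prob_space_gauss_seq)
  note [simp] = integrable_seq_ratio[of n \<theta> \<eta>] integrable_seq_ratio_sq[of n \<theta> \<eta>]
  have 1: "(\<integral>x. seq_ratio n \<theta> \<eta> x \<partial>gauss_seq n \<theta>) = 1"
    by (subst integral_eq_nn_integral) (simp_all add: nn_integral_seq_ratio)
  have 2: "(\<integral>x. (seq_ratio n \<theta> \<eta> x)\<^sup>2 \<partial>gauss_seq n \<theta>) = exp (\<Sum>i\<in>{1..n}. (\<eta> i - \<theta> i)\<^sup>2)"
    by (subst integral_eq_nn_integral) (simp_all add: nn_integral_seq_ratio_sq)
  have eq: "(\<lambda>x. (seq_ratio n \<theta> \<eta> x - 1)\<^sup>2) = (\<lambda>x. (seq_ratio n \<theta> \<eta> x)\<^sup>2 - 2 * seq_ratio n \<theta> \<eta> x + 1)"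
    by (simp add: power2_eq_square algebra_simps)
  have "integrable (gauss_seq n \<theta>) (\<lambda>x. (seq_ratio n \<theta> \<eta> x - 1)\<^sup>2)"
    unfolding eq by (intro Bochner_Integration.integrable_add Bochner_Integration.integrable_diff) auto
  then have "(\<integral>\<^sup>+x. ennreal ((seq_ratio n \<theta> \<eta> x - 1)\<^sup>2) \<partial>gauss_seq n \<theta>)
      = ennreal (\<integral>x. (seq_ratio n \<theta> \<eta> x - 1)\<^sup>2 \<partial>gauss_seq n \<theta>)"
    by (intro nn_integral_eq_integral) auto
  also have "(\<integral>x. (seq_ratio n \<theta> \<eta> x - 1)\<^sup>2 \<partial>gauss_seq n \<theta>)
      = exp (\<Sum>i\<in>{1..n}. (\<eta> i - \<theta> i)\<^sup>2) - 1"
    unfolding eq by (simp add: 1 2 prob_space)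
  finally show ?thesis .
qed

text \<open>The difference of the means is the integral of the centred statistic against
  \<open>?L - 1\<close>. Cauchy-Schwarz splits this into the variance and the chi-square divergence;
  infinite variance is covered by the values in \<open>ennreal\<close>.\<close>

lemma hammersley_chapman_robbins:
  assumes int\<theta>: "integrable (gauss_seq n \<theta>) (\<lambda>x. t x i)"
    and int\<eta>: "integrable (gauss_seq n \<eta>) (\<lambda>x. t x i)"
  shows "ennreal ((mean n \<eta> t i - mean n \<theta> t i)\<^sup>2)
    \<le> coord_var n \<theta> t i * ennreal (exp (\<Sum>j\<in>{1..n}. (\<eta> j - \<theta> j)\<^sup>2) - 1)"
proof -
  let ?P = "gauss_seq n \<theta>" and ?L = "seq_ratio n \<theta> \<eta>" and ?m = "mean n \<theta> t i"
  interpret P: prob_space ?P by (rule prob_space_gauss_seq)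
  interpret Q: prob_space "gauss_seq n \<eta>" by (rule prob_space_gauss_seq)
  note [measurable] = borel_measurable_integrable[OF int\<theta>]
  have int: "integrable ?P (\<lambda>x. t x i - ?m)" and "integrable (gauss_seq n \<eta>) (\<lambda>x. t x i - ?m)"
    using int\<theta> int\<eta> by auto
  then have intL: "integrable ?P (\<lambda>x. ?L x * (t x i - ?m))"
    unfolding density_seq_ratio[of n \<theta> \<eta>, symmetric] by (simp add: integrable_real_density)
  have "mean n \<eta> t i - ?m = (\<integral>x. t x i - ?m \<partial>gauss_seq n \<eta>)"
    using int\<eta> by (simp add: mean_def Q.prob_space)
  also have "\<dots> = (\<integral>x. ?L x * (t x i - ?m) \<partial>?P)"
    by (subst density_seq_ratio[of n \<theta> \<eta>, symmetric]) (rule integral_real_density; simp)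
  \<comment> \<open>The subtracted integral is 0 because \<open>?m\<close> is the mean; it turns the
    factor \<open>?L x\<close> into \<open>?L x - 1\<close>.\<close>
  also have "\<dots> = (\<integral>x. ?L x * (t x i - ?m) \<partial>?P) - (\<integral>x. t x i - ?m \<partial>?P)"
    using int\<theta> by (simp add: mean_def P.prob_space)
  also have "\<dots> = (\<integral>x. ?L x * (t x i - ?m) - (t x i - ?m) \<partial>?P)"
    using intL int by simp
  also have "(\<lambda>x. ?L x * (t x i - ?m) - (t x i - ?m)) = (\<lambda>x. (t x i - ?m) * (?L x - 1))"
    by (simp add: algebra_simps)
  finally have eq: "mean n \<eta> t i - ?m = (\<integral>x. (t x i - ?m) * (?L x - 1) \<partial>?P)" .
  have prod_int: "integrable ?P (\<lambda>x. (t x i - ?m) * (?L x - 1))"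
    using Bochner_Integration.integrable_diff[OF intL int] by (simp add: algebra_simps)
  have "ennreal \<bar>mean n \<eta> t i - ?m\<bar> \<le> (\<integral>\<^sup>+x. ennreal \<bar>(t x i - ?m) * (?L x - 1)\<bar> \<partial>?P)"
    unfolding eq real_norm_def[symmetric] by (rule integral_norm_bound_ennreal[OF prod_int])
  also have "\<dots> = (\<integral>\<^sup>+x. ennreal \<bar>t x i - ?m\<bar> * ennreal \<bar>?L x - 1\<bar> \<partial>?P)"
    by (simp add: abs_mult ennreal_mult)
  finally have "(ennreal \<bar>mean n \<eta> t i - ?m\<bar>)\<^sup>2
      \<le> (\<integral>\<^sup>+x. ennreal \<bar>t x i - ?m\<bar> * ennreal \<bar>?L x - 1\<bar> \<partial>?P)\<^sup>2"
    by (rule power_mono) simp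
  also have "\<dots> \<le> (\<integral>\<^sup>+x. (ennreal \<bar>t x i - ?m\<bar>)\<^sup>2 \<partial>?P) * (\<integral>\<^sup>+x. (ennreal \<bar>?L x - 1\<bar>)\<^sup>2 \<partial>?P)"
    by (rule Cauchy_Schwarz_nn_integral) measurable
  finally show ?thesis
    by (simp add: ennreal_power coord_var_def nn_integral_chi_square)
qed

section \<open>Bias-variance decomposition\<close>

lemma (in prob_space) nn_second_moment_decomp:
  fixes f :: "'a \<Rightarrow> real"
  assumes f: "integrable M f"
  shows "(\<integral>\<^sup>+x. ennreal ((f x - c)\<^sup>2) \<partial>M)
    = (\<integral>\<^sup>+x. ennreal ((f x - expectation f)\<^sup>2) \<partial>M) + ennreal ((expectation f - c)\<^sup>2)"
proof -
  let ?m = "expectation f"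
  note [measurable] = borel_measurable_integrable[OF f]
  have 1: "(f x - a)\<^sup>2 = (f x - b)\<^sup>2 + (2 * (b - a) * (f x - b) + (b - a)\<^sup>2)" for a b x
    by (simp add: power2_eq_square algebra_simps)
  \<comment> \<open>Changing the centre adds an affine function of \<open>f\<close>, so square
    integrability about one centre gives it about every other. In the divergent case both sides of
    the claim are therefore infinite.\<close>
  have step: "integrable M (\<lambda>x. (f x - a)\<^sup>2)" if "integrable M (\<lambda>x. (f x - b)\<^sup>2)" for a b
    unfolding 1[of _ a b] using that f by (intro Bochner_Integration.integrable_add) auto
  show ?thesis
  proof (cases "integrable M (\<lambda>x. (f x - ?m)\<^sup>2)")
    case True
    have "(\<integral>x. (f x - c)\<^sup>2 \<partial>M) = (\<integral>x. (f x - ?m)\<^sup>2 \<partial>M) + (?m - c)\<^sup>2"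
      unfolding 1[of _ c ?m] using True f by (simp add: prob_space)
    then show ?thesis
      using True step[OF True, of c]
      by (simp add: nn_integral_eq_integral)
  next
    case False
    then have "\<not> integrable M (\<lambda>x. (f x - c)\<^sup>2)"
      using step[of c ?m] by auto
    moreover have "(\<integral>\<^sup>+x. ennreal ((f x - b)\<^sup>2) \<partial>M) = \<infinity>" if "\<not> integrable M (\<lambda>x. (f x - b)\<^sup>2)" for b
      using that by (auto simp: integrable_iff_bounded not_less top_unique)
    ultimately show ?thesis using False by simp
  qed
qed

lemma risk_eq_sum:
  assumes "\<And>i. i \<in> {1..n} \<Longrightarrow> integrable (gauss_seq n \<theta>) (\<lambda>x. t x i)"
  shows "risk n \<theta> t = (\<Sum>i\<in>{1..n}. \<integral>\<^sup>+x. ennreal ((t x i - \<theta> i)\<^sup>2) \<partial>gauss_seq n \<theta>)"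
proof -
  have "risk n \<theta> t = (\<integral>\<^sup>+x. (\<Sum>i\<in>{1..n}. ennreal ((t x i - \<theta> i)\<^sup>2)) \<partial>gauss_seq n \<theta>)"
    by (simp add: risk_def L2_set_def sum_nonneg)
  also have "\<dots> = (\<Sum>i\<in>{1..n}. \<integral>\<^sup>+x. ennreal ((t x i - \<theta> i)\<^sup>2) \<partial>gauss_seq n \<theta>)"
    by (rule nn_integral_sum)
      (use assms[THEN borel_measurable_integrable] in simp)
  finally show ?thesis .
qed

lemma sq_bias_eq: "sq_bias n \<theta> t = ennreal (\<Sum>i\<in>{1..n}. (mean n \<theta> t i - \<theta> i)\<^sup>2)"
  by (simp add: sq_bias_def L2_set_def sum_nonneg)

lemma bias_variance_decomposition:
  assumes "\<And>i. i \<in> {1..n} \<Longrightarrow> integrable (gauss_seq n \<theta>) (\<lambda>x. t x i)"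
  shows "risk n \<theta> t = (\<Sum>i\<in>{1..n}. coord_var n \<theta> t i) + sq_bias n \<theta> t"
proof -
  interpret prob_space "gauss_seq n \<theta>" by (rule prob_space_gauss_seq)
  have "risk n \<theta> t
      = (\<Sum>i\<in>{1..n}. coord_var n \<theta> t i + ennreal ((mean n \<theta> t i - \<theta> i)\<^sup>2))"
    by (subst risk_eq_sum)
      (auto simp: coord_var_def mean_def intro!: sum.cong nn_second_moment_decomp assms)
  then show ?thesis
    by (simp add: sq_bias_eq sum.distrib)
qed

subsection \<open>Lower bounds by averaging over product grids\<close>

lemma hammersley_chapman_robbins_real:
  assumes "integrable (gauss_seq n \<theta>) (\<lambda>x. t x i)" "integrable (gauss_seq n \<eta>) (\<lambda>x. t x i)"
    and fin: "coord_var n \<theta> t i < \<infinity>" and d: "(\<Sum>j\<in>{1..n}. (\<eta> j - \<theta> j)\<^sup>2) \<le> d"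
  shows "(mean n \<eta> t i - mean n \<theta> t i)\<^sup>2 \<le> enn2real (coord_var n \<theta> t i) * (exp d - 1)"
proof -
  have 0: "0 \<le> d"
    using d by (meson order_trans sum_nonneg zero_le_power2)
  have "ennreal ((mean n \<eta> t i - mean n \<theta> t i)\<^sup>2)
      \<le> coord_var n \<theta> t i * ennreal (exp (\<Sum>j\<in>{1..n}. (\<eta> j - \<theta> j)\<^sup>2) - 1)"
    by (rule hammersley_chapman_robbins) fact+
  also have "\<dots> \<le> coord_var n \<theta> t i * ennreal (exp d - 1)"
    using d by (intro mult_left_mono ennreal_leI) auto
  also have "coord_var n \<theta> t i = ennreal (enn2real (coord_var n \<theta> t i))"
    using fin by simp
  finally have "ennreal ((mean n \<eta> t i - mean n \<theta> t i)\<^sup>2)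
      \<le> ennreal (enn2real (coord_var n \<theta> t i) * (exp d - 1))"
    using 0 by (simp add: ennreal_mult)
  then show ?thesis
    using 0 by (subst (asm) ennreal_le_iff) auto
qed

text \<open>Turns a bound for the sum along every line in direction \<open>i\<close> into a bound
  for the sum over the whole grid, so that several directions can be added at the same grid
  points.\<close>

lemma sum_PiE_resample:
  fixes F :: "('a \<Rightarrow> 'b) \<Rightarrow> real"
  assumes "i \<in> I"
  shows "(\<Sum>w\<in>I \<rightarrow>\<^sub>E A. \<Sum>a\<in>A. F (w(i := a))) = real (card A) * (\<Sum>w\<in>I \<rightarrow>\<^sub>E A. F w)"
proof -
  have "(\<Sum>w\<in>I \<rightarrow>\<^sub>E A. \<Sum>a\<in>A. F (w(i := a))) = (\<Sum>(w, a)\<in>(I \<rightarrow>\<^sub>E A) \<times> A. F (w(i := a)))"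
    by (rule sum.cartesian_product)
  \<comment> \<open>Exchanging \<open>a\<close> with the value of \<open>w\<close> at \<open>i\<close> is an involution.\<close>
  also have "\<dots> = (\<Sum>(w, a)\<in>(I \<rightarrow>\<^sub>E A) \<times> A. F w)"
    by (rule sum.reindex_bij_witness[where i = "\<lambda>(w, a). (w(i := a), w i)" and j = "\<lambda>(w, a). (w(i := a), w i)"])
       (use assms in \<open>auto simp: PiE_iff extensional_def\<close>)
  also have "\<dots> = (\<Sum>w\<in>I \<rightarrow>\<^sub>E A. \<Sum>a\<in>A. F w)"
    by (rule sum.cartesian_product[symmetric])
  finally show ?thesis
    by (simp add: sum_distrib_left)
qed

text \<open>Passage from extended to real variances: a finite bound on the total excludes infinite
  summands, which \<open>enn2real\<close> would send to 0.\<close>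

lemma sum_enn2real_le:
  assumes "(\<Sum>i\<in>I. f i) \<le> ennreal V" "0 \<le> V" "finite I"
  shows "(\<Sum>i\<in>I. enn2real (f i)) \<le> V" and "i \<in> I \<Longrightarrow> f i < \<infinity>"
proof -
  have fin: "f i < \<infinity>" if "i \<in> I" for i
  proof -
    have "f i \<le> (\<Sum>i\<in>I. f i)"
      using that assms by (intro member_le_sum) auto
    also have "\<dots> < \<infinity>"
      using assms(1) by (simp add: order_le_less_trans)
    finally show ?thesis .
  qed
  then show "i \<in> I \<Longrightarrow> f i < \<infinity>" .
  have "ennreal (\<Sum>i\<in>I. enn2real (f i)) = (\<Sum>i\<in>I. f i)"
    using fin by (subst sum_ennreal[symmetric]) (auto intro!: sum.cong)
  then show "(\<Sum>i\<in>I. enn2real (f i)) \<le> V"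
    using assms by (metis ennreal_le_iff)
qed

text \<open>Gives \<open>exp 1 - 1 \<le> 9 / 5\<close>; the gap between 5/9 and 1/2 pays for the
  bias at the ends of a segment. The quadratic bound for \<open>exp\<close> is sharp enough at
  1/16.\<close>

lemma exp_1_le: "exp 1 \<le> (14 / 5 :: real)"
proof -
  have "exp 1 = exp (1 / 16 :: real) ^ 16"
    by (simp flip: exp_of_nat_mult)
  also have "\<dots> \<le> (1 + 1 / 16 + (1 / 16)\<^sup>2) ^ 16"
    by (intro power_mono exp_bound) auto
  also have "\<dots> \<le> 14 / 5"
    by (simp add: power2_eq_square power_divide)
  finally show ?thesis .
qed

text \<open>The dimension is fixed and \<open>D\<close> may be any bound on the bias: the grid is
  made so long that the bias at its ends is small against the change of the parameter.\<close>

lemma worst_variance_ge_half: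
  fixes D :: real
  assumes k: "k \<le> n"
    and int: "\<And>\<theta> i. \<theta> \<in> sparse_vectors n k \<Longrightarrow> i \<in> {1..n} \<Longrightarrow> integrable (gauss_seq n \<theta>) (\<lambda>x. t x i)"
    and bias: "\<And>\<theta>. \<theta> \<in> sparse_vectors n k \<Longrightarrow> sq_bias n \<theta> t \<le> ennreal (D\<^sup>2)" "0 \<le> D"
  shows "ennreal (real k / 2) \<le> (SUP \<theta>\<in>sparse_vectors n k. \<Sum>i\<in>{1..n}. coord_var n \<theta> t i)"
    (is "_ \<le> ?S")
proof (cases "?S = \<infinity>")
  case False
  then obtain V where V: "?S = ennreal V" "0 \<le> V"
    by (cases ?S) auto
  have le_V: "(\<Sum>i\<in>{1..n}. coord_var n \<theta> t i) \<le> ennreal V" if "\<theta> \<in> sparse_vectors n k" for \<theta>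
    unfolding V(1)[symmetric] using that by (rule SUP_upper)
  have bias_le: "\<bar>mean n \<theta> t i - \<theta> i\<bar> \<le> D" if "\<theta> \<in> sparse_vectors n k" "i \<in> {1..n}" for \<theta> i
  proof -
    have "(mean n \<theta> t i - \<theta> i)\<^sup>2 \<le> (\<Sum>i\<in>{1..n}. (mean n \<theta> t i - \<theta> i)\<^sup>2)"
      using that by (intro member_le_sum) auto
    also have "\<dots> \<le> D\<^sup>2"
      using bias(1)[OF that(1)] by (simp add: sq_bias_eq)
    finally show ?thesis
      using bias(2) by (simp add: abs_le_square_iff[symmetric])
  qed
  define v where "v \<theta> i = enn2real (coord_var n \<theta> t i)" for \<theta> i
  \<comment> \<open>\<open>40 * D \<le> K\<close> makes \<open>4 * D\<close> at most a tenth of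
    \<open>K\<close>, which is the loss allowed in \<open>line\<close>; the added 1 keeps the grid
    nonempty.\<close>
  define K where "K = nat \<lceil>40 * D\<rceil> + 1"
  have K: "K > 0" "40 * D \<le> real K"
    by (auto simp: K_def) linarith
  define \<Omega> where "\<Omega> = {1..k} \<rightarrow>\<^sub>E {..<K}"
  have \<Omega>: "finite \<Omega>" "card \<Omega> > 0"
    using K by (auto simp: \<Omega>_def finite_PiE card_PiE)
  define \<theta> where "\<theta> w i = (if i \<in> {1..k} then real (w i) else if i \<in> {1..n} then 0 else undefined)"
    for w :: "nat \<Rightarrow> nat" and i
  \<comment> \<open>Needed beyond the grid: the telescoping sum in \<open>line\<close> ends at
    \<open>w(i := K)\<close>, where only the bias bound is used.\<close>
  have sp: "\<theta> w \<in> sparse_vectors n k" for w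
  proof -
    have "card {i \<in> {1..n}. \<theta> w i \<noteq> 0} \<le> card {1..k}"
      by (rule card_mono) (auto simp: \<theta>_def split: if_splits)
    then show ?thesis
      using k by (auto simp: sparse_vectors_def PiE_iff extensional_def \<theta>_def)
  qed
  have line: "real K / 2 \<le> (\<Sum>j<K. v (\<theta> (w(i := j))) i)" if i: "i \<in> {1..k}" for w i
  proof -
    have i': "i \<in> {1..n}" using i k by auto
    define m where "m j = mean n (\<theta> (w(i := j))) t i" for j
    have m: "\<bar>m j - real j\<bar> \<le> D" for j
      using bias_le[OF sp i', of "w(i := j)"] i by (simp add: m_def \<theta>_def)
    \<comment> \<open>With x the increment of the mean over a unit step, x^2 \<ge> 2 x - 1 makes the
      inequality linear in x, so that it telescopes.\<close>
    have step: "2 * (m (Suc j) - m j) - 1 \<le> 9 / 5 * v (\<theta> (w(i := j))) i" for j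
    proof -
      have "(\<Sum>l\<in>{1..n}. (\<theta> (w(i := Suc j)) l - \<theta> (w(i := j)) l)\<^sup>2) = (\<Sum>l\<in>{1..n}. if l = i then 1 else 0)"
        using i by (intro sum.cong) (auto simp: \<theta>_def)
      also have "\<dots> \<le> 1" by simp
      finally have "(m (Suc j) - m j)\<^sup>2 \<le> v (\<theta> (w(i := j))) i * (exp 1 - 1)"
        unfolding m_def v_def
        by (intro hammersley_chapman_robbins_real int sp i' sum_enn2real_le(2)[OF le_V]) (use V in auto)
      also have "\<dots> \<le> v (\<theta> (w(i := j))) i * (9 / 5)"
        using exp_1_le by (intro mult_left_mono) (auto simp: v_def)
      finally show ?thesis
        using zero_le_power2[of "m (Suc j) - m j - 1"] by (simp add: power2_eq_square algebra_simps)
    qed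
    have "9 / 10 * real K \<le> 2 * (real K - 2 * D) - real K"
      using K by simp
    also have "\<dots> \<le> 2 * (m K - m 0) - real K"
      using m[of K] m[of 0] by (simp add: abs_le_iff)
    also have "\<dots> = (\<Sum>j<K. 2 * (m (Suc j) - m j) - 1)"
      using sum_lessThan_telescope[of m K] by (simp add: sum_subtractf flip: sum_distrib_left)
    also have "\<dots> \<le> (\<Sum>j<K. 9 / 5 * v (\<theta> (w(i := j))) i)"
      by (intro sum_mono step)
    also have "\<dots> = 9 / 5 * (\<Sum>j<K. v (\<theta> (w(i := j))) i)"
      by (rule sum_distrib_left[symmetric])
    finally show ?thesis
      by simp
  qed
  \<comment> \<open>Averaging \<open>line\<close> over the grid: component \<open>i\<close> has mean
    variance at least 1/2 over the points of \<open>\<Omega>\<close>, which are the same for all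
    \<open>i\<close>.\<close>
  have "real (card \<Omega>) / 2 \<le> (\<Sum>w\<in>\<Omega>. v (\<theta> w) i)" if i: "i \<in> {1..k}" for i
  proof -
    have "real (card \<Omega>) * (real K / 2) \<le> (\<Sum>w\<in>\<Omega>. \<Sum>j<K. v (\<theta> (w(i := j))) i)"
      using sum_bounded_below[of \<Omega> "real K / 2", OF line[OF i]] by simp
    also have "\<dots> = real K * (\<Sum>w\<in>\<Omega>. v (\<theta> w) i)"
      unfolding \<Omega>_def using sum_PiE_resample[OF i, where A = "{..<K}" and F = "\<lambda>w. v (\<theta> w) i"] by simp
    finally show ?thesis
      using K by (simp add: field_simps)
  qed
  then have "(\<Sum>i\<in>{1..k}. real (card \<Omega>) / 2) \<le> (\<Sum>i\<in>{1..k}. \<Sum>w\<in>\<Omega>. v (\<theta> w) i)"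
    by (rule sum_mono)
  also have "\<dots> = (\<Sum>w\<in>\<Omega>. \<Sum>i\<in>{1..k}. v (\<theta> w) i)"
    by (rule sum.swap)
  also have "\<dots> \<le> (\<Sum>w\<in>\<Omega>. \<Sum>i\<in>{1..n}. v (\<theta> w) i)"
    using k by (intro sum_mono sum_mono2) (auto simp: v_def)
  also have "\<dots> \<le> (\<Sum>w\<in>\<Omega>. V)"
    unfolding v_def using V by (intro sum_mono sum_enn2real_le le_V sp) auto
  finally have "real k / 2 \<le> V"
    using \<Omega> by (simp add: field_simps)
  then show ?thesis
    unfolding V(1) by (rule ennreal_leI)
next
  case True
  then show ?thesis by (simp only: True infinity_ennreal_def top_greatest)
qed

text \<open>
  The coordinates \<open>1, \<dots>, k N\<close> form \<open>k\<close> blocks of length \<open>N\<close>; a parameter has one spike of height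
  \<open>\<mu>\<close> in each block.
\<close>

lemma spike_tradeoff:
  fixes \<mu> \<beta> V :: real
  assumes N: "N \<ge> 2" "k * N \<le> n"
    and int: "\<And>\<theta> i. \<theta> \<in> sparse_vectors n k \<Longrightarrow> i \<in> {1..n} \<Longrightarrow> integrable (gauss_seq n \<theta>) (\<lambda>x. t x i)"
    and bias: "\<And>\<theta>. \<theta> \<in> sparse_vectors n k \<Longrightarrow> sq_bias n \<theta> t \<le> ennreal \<beta>" "0 \<le> \<beta>"
    and var: "\<And>\<theta>. \<theta> \<in> sparse_vectors n k \<Longrightarrow> (\<Sum>i\<in>{1..n}. coord_var n \<theta> t i) \<le> ennreal V" "0 \<le> V"
  shows "real N * (real k * \<mu>\<^sup>2 / 4 - 4 * \<beta>) \<le> exp (2 * \<mu>\<^sup>2) * V"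
proof -
  \<comment> \<open>Position \<open>j\<close> of block \<open>b\<close>, both counted from 0, while
    coordinates start at 1. Hence quotient and remainder of \<open>i - 1\<close> by \<open>N\<close>
    recover block and position.\<close>
  define idx where "idx b j = 1 + b * N + j" for b j :: nat
  have idx: "idx b j \<in> {1..n}" if "b < k" "j < N" for b j
  proof -
    have "b * N + j < (b + 1) * N" using that by simp
    also have "\<dots> \<le> k * N" using that by (intro mult_right_mono) auto
    finally show ?thesis using N by (simp add: idx_def)
  qed
  have inj: "inj_on (\<lambda>(b, j). idx b j) ({..<k} \<times> {..<N})"
  proof (rule inj_onI, clarsimp)
    fix b j b' j' assume *: "j < N" "j' < N" "idx b j = idx b' j'"
    from arg_cong[OF *(3), of "\<lambda>i. (i - 1) div N"] arg_cong[OF *(3), of "\<lambda>i. (i - 1) mod N"] *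
    show "b = b' \<and> j = j'" by (simp add: idx_def)
  qed
  define \<theta> where "\<theta> w i =
      (if i \<in> {1..n} then if (i - 1) div N < k \<and> w ((i - 1) div N) = (i - 1) mod N then \<mu> else 0 else undefined)"
    for w :: "nat \<Rightarrow> nat" and i
  have \<theta>_idx: "\<theta> w (idx b j) = (if w b = j then \<mu> else 0)" if "b < k" "j < N" for w b j
    using idx[OF that] that by (simp add: \<theta>_def idx_def)
  have sp: "\<theta> w \<in> sparse_vectors n k" for w
  proof -
    have "{i \<in> {1..n}. \<theta> w i \<noteq> 0} \<subseteq> (\<lambda>b. idx b (w b)) ` {..<k}"
    proof
      fix i assume "i \<in> {i \<in> {1..n}. \<theta> w i \<noteq> 0}"
      then have "i \<ge> 1" "(i - 1) div N < k" "w ((i - 1) div N) = (i - 1) mod N"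
        by (auto simp: \<theta>_def split: if_splits)
      then show "i \<in> (\<lambda>b. idx b (w b)) ` {..<k}"
        by (intro image_eqI[of _ _ "(i - 1) div N"]) (auto simp: idx_def)
    qed
    then have "card {i \<in> {1..n}. \<theta> w i \<noteq> 0} \<le> card {..<k}"
      by (meson card_image_le card_mono finite_imageI finite_lessThan order_trans)
    then show ?thesis
      by (auto simp: sparse_vectors_def PiE_iff extensional_def \<theta>_def)
  qed
  \<comment> \<open>\<open>c\<close> is the bias and \<open>v\<close> the variance of a single
    component; \<open>B\<close> and \<open>W\<close> collect squared bias and variance over one
    block.\<close>
  define c where "c w i = mean n (\<theta> w) t i - \<theta> w i" for w i
  define v where "v w i = enn2real (coord_var n (\<theta> w) t i)" for w i
  define B where "B w b = (\<Sum>j<N. (c w (idx b j))\<^sup>2)" for w b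
  define W where "W w b = (\<Sum>j<N. v w (idx b j))" for w b
  have v_nonneg: "0 \<le> v w i" for w i by (simp add: v_def)
  have blocks: "(\<Sum>b<k. \<Sum>j<N. f (idx b j)) \<le> (\<Sum>i\<in>{1..n}. f i)" if "\<And>i. 0 \<le> f i" for f :: "nat \<Rightarrow> real"
  proof -
    have "(\<Sum>b<k. \<Sum>j<N. f (idx b j)) = (\<Sum>p\<in>{..<k} \<times> {..<N}. f (case p of (b, j) \<Rightarrow> idx b j))"
      by (simp add: sum.cartesian_product case_prod_unfold)
    also have "\<dots> = (\<Sum>i\<in>(\<lambda>(b, j). idx b j) ` ({..<k} \<times> {..<N}). f i)"
      using inj by (subst sum.reindex) auto
    also have "\<dots> \<le> (\<Sum>i\<in>{1..n}. f i)"
      using that idx by (intro sum_mono2) auto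
    finally show ?thesis .
  qed
  have B_le: "(\<Sum>b<k. B w b) \<le> \<beta>" for w
    unfolding B_def using blocks[of "\<lambda>i. (c w i)\<^sup>2"] bias(1)[OF sp[of w]] bias(2)
    by (simp add: sq_bias_eq c_def)
  have W_le: "(\<Sum>b<k. W w b) \<le> V" for w
    unfolding W_def using blocks[of "v w", OF v_nonneg] sum_enn2real_le(1)[OF var(1)[OF sp[of w]] var(2)]
    by (simp add: v_def)
  \<comment> \<open>Moving the spike of block \<open>b\<close> from \<open>j'\<close> to
    \<open>j\<close> shifts the mean of component \<open>idx b j\<close> by \<open>\<mu>\<close> up
    to two bias terms. For \<open>j' = j\<close> nothing moves, and the subtracted
    \<open>\<mu>\<^sup>2 / 2\<close> makes the bound trivial, so that all pairs can be
    summed.\<close>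
  have pair: "\<mu>\<^sup>2 / 2 - (if j' = j then \<mu>\<^sup>2 / 2 else 0)
        - 2 * (c (w(b := j)) (idx b j))\<^sup>2 - 2 * (c (w(b := j')) (idx b j))\<^sup>2
      \<le> exp (2 * \<mu>\<^sup>2) * v (w(b := j')) (idx b j)"
    if b: "b < k" and j: "j < N" and j': "j' < N" for w b j j'
  proof (cases "j' = j")
    case True
    have "- 4 * (c (w(b := j)) (idx b j))\<^sup>2 \<le> 0" by simp
    also have "0 \<le> exp (2 * \<mu>\<^sup>2) * v (w(b := j')) (idx b j)" by (simp add: v_nonneg)
    finally show ?thesis using True by simp
  next
    case False
    let ?\<theta> = "\<theta> (w(b := j'))" and ?\<eta> = "\<theta> (w(b := j))" and ?i = "idx b j"
    let ?x = "c (w(b := j)) ?i" and ?y = "c (w(b := j')) ?i"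
    have "(\<Sum>l\<in>{1..n}. (?\<eta> l - ?\<theta> l)\<^sup>2)
        \<le> (\<Sum>l\<in>{1..n}. (if l = idx b j then \<mu>\<^sup>2 else 0) + (if l = idx b j' then \<mu>\<^sup>2 else 0))"
    proof (rule sum_mono)
      fix l assume l: "l \<in> {1..n}"
      show "(?\<eta> l - ?\<theta> l)\<^sup>2 \<le> (if l = idx b j then \<mu>\<^sup>2 else 0) + (if l = idx b j' then \<mu>\<^sup>2 else 0)"
      proof (cases "(l - 1) div N = b")
        case True
        then have "l = idx b ((l - 1) mod N)" "(l - 1) mod N < N"
          using l N by (auto simp: idx_def)
        then obtain a where a: "l = idx b a" "a < N" by blast
        have "idx b a = idx b a' \<longleftrightarrow> a = a'" for a' by (simp add: idx_def)
        then show ?thesis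
          unfolding a(1) by (simp add: \<theta>_idx[OF b a(2)])
      next
        case False
        then have "?\<eta> l = ?\<theta> l" by (simp add: \<theta>_def)
        then show ?thesis by simp
      qed
    qed
    also have "\<dots> = 2 * \<mu>\<^sup>2"
      using idx[OF b j] idx[OF b j'] by (simp add: sum.distrib)
    finally have "(mean n ?\<eta> t ?i - mean n ?\<theta> t ?i)\<^sup>2 \<le> v (w(b := j')) ?i * (exp (2 * \<mu>\<^sup>2) - 1)"
      unfolding v_def
      by (intro hammersley_chapman_robbins_real int sp idx b j sum_enn2real_le(2)[OF var(1)[OF sp] var(2)])
         (use idx b j in auto)
    also have "\<dots> \<le> exp (2 * \<mu>\<^sup>2) * v (w(b := j')) ?i"
      using v_nonneg by (simp add: algebra_simps)
    also have "mean n ?\<eta> t ?i - mean n ?\<theta> t ?i = \<mu> + ?x - ?y"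
      using False b j by (simp add: c_def \<theta>_idx)
    finally have "(\<mu> + ?x - ?y)\<^sup>2 \<le> exp (2 * \<mu>\<^sup>2) * v (w(b := j')) ?i" .
    \<comment> \<open>A sum of squares certifies that the squared shift is at least half of
      \<open>\<mu>\<^sup>2\<close> minus twice each squared bias.\<close>
    moreover have "(\<mu> + ?x - ?y)\<^sup>2 - (\<mu>\<^sup>2 / 2 - 2 * ?x\<^sup>2 - 2 * ?y\<^sup>2)
        = (\<mu> + 2 * (?x - ?y))\<^sup>2 / 2 + (?x + ?y)\<^sup>2"
      by (simp add: power2_eq_square field_simps)
    moreover have "0 \<le> (\<mu> + 2 * (?x - ?y))\<^sup>2 / 2 + (?x + ?y)\<^sup>2" by simp
    ultimately show ?thesis unfolding if_not_P[OF False] by linarith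
  qed
  \<comment> \<open>Sum of \<open>pair\<close> over all \<open>j\<close> and \<open>j'\<close>. As
    \<open>N \<ge> 2\<close>, the diagonal costs at most half of the main term, which leaves the
    factor 1/4; each of the two bias sums is at most \<open>2 * N\<close> times the sum of
    \<open>B\<close>.\<close>
  have block: "(real N)\<^sup>2 * \<mu>\<^sup>2 / 4 - 4 * real N * (\<Sum>j<N. B (w(b := j)) b)
      \<le> exp (2 * \<mu>\<^sup>2) * (\<Sum>j<N. W (w(b := j)) b)" if b: "b < k" for w b
  proof -
    let ?x = "\<lambda>j' j. (c (w(b := j')) (idx b j))\<^sup>2" and ?S = "\<Sum>j<N. B (w(b := j)) b"
    have diag: "(\<Sum>j<N. ?x j j) \<le> ?S"
      unfolding B_def by (intro sum_mono member_le_sum) auto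
    have S: "0 \<le> ?S" unfolding B_def by (intro sum_nonneg) auto
    have "(\<Sum>j'<N. \<Sum>j<N. \<mu>\<^sup>2 / 2 - (if j' = j then \<mu>\<^sup>2 / 2 else 0) - 2 * ?x j j - 2 * ?x j' j)
        \<le> (\<Sum>j'<N. \<Sum>j<N. exp (2 * \<mu>\<^sup>2) * v (w(b := j')) (idx b j))"
      using b by (intro sum_mono pair) auto
    also have "\<dots> = exp (2 * \<mu>\<^sup>2) * (\<Sum>j<N. W (w(b := j)) b)"
      by (simp add: W_def sum_distrib_left)
    also have "(\<Sum>j'<N. \<Sum>j<N. \<mu>\<^sup>2 / 2 - (if j' = j then \<mu>\<^sup>2 / 2 else 0) - 2 * ?x j j - 2 * ?x j' j)
        = real N * (real N * (\<mu>\<^sup>2 / 2)) - real N * (\<mu>\<^sup>2 / 2) - 2 * real N * (\<Sum>j<N. ?x j j) - 2 * ?S"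
      by (simp add: sum_subtractf B_def flip: sum_distrib_left) (simp add: field_simps)
    finally have 1: "real N * (real N * (\<mu>\<^sup>2 / 2)) - real N * (\<mu>\<^sup>2 / 2) - 2 * real N * (\<Sum>j<N. ?x j j) - 2 * ?S
      \<le> exp (2 * \<mu>\<^sup>2) * (\<Sum>j<N. W (w(b := j)) b)" .
    have "real N * (\<mu>\<^sup>2 / 2) * 2 \<le> real N * (\<mu>\<^sup>2 / 2) * real N"
      using N by (intro mult_left_mono) auto
    moreover have "real N * (\<Sum>j<N. ?x j j) \<le> real N * ?S"
      using diag by (rule mult_left_mono) simp
    moreover have "1 * ?S \<le> real N * ?S"
      using S N by (intro mult_right_mono) auto
    ultimately show ?thesis
      using 1 by (simp add: power2_eq_square algebra_simps)
  qed
  define \<Omega> where "\<Omega> = {..<k} \<rightarrow>\<^sub>E {..<N}"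
  have \<Omega>: "finite \<Omega>" "card \<Omega> > 0"
    using N by (auto simp: \<Omega>_def finite_PiE card_PiE)
  have resample: "(\<Sum>w\<in>\<Omega>. \<Sum>j<N. F (w(b := j))) = real N * (\<Sum>w\<in>\<Omega>. F w)" if "b < k"
    for b and F :: "(nat \<Rightarrow> nat) \<Rightarrow> real"
    unfolding \<Omega>_def using sum_PiE_resample[of b "{..<k}" F "{..<N}"] that by simp
  \<comment> \<open>Summing \<open>block\<close> over all configurations, \<open>resample\<close>
    replaces the inner sum over the spike position by a factor \<open>N\<close>.\<close>
  have "real (card \<Omega>) * ((real N)\<^sup>2 * \<mu>\<^sup>2 / 4) - 4 * (real N)\<^sup>2 * (\<Sum>w\<in>\<Omega>. B w b)
      \<le> exp (2 * \<mu>\<^sup>2) * real N * (\<Sum>w\<in>\<Omega>. W w b)" if b: "b < k" for b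
  proof -
    have "(\<Sum>w\<in>\<Omega>. (real N)\<^sup>2 * \<mu>\<^sup>2 / 4 - 4 * real N * (\<Sum>j<N. B (w(b := j)) b))
        \<le> (\<Sum>w\<in>\<Omega>. exp (2 * \<mu>\<^sup>2) * (\<Sum>j<N. W (w(b := j)) b))"
      by (intro sum_mono block b)
    then show ?thesis
      using resample[OF b, of "\<lambda>w. B w b"] resample[OF b, of "\<lambda>w. W w b"]
      by (simp add: sum_subtractf power2_eq_square mult.assoc flip: sum_distrib_left)
  qed
  then have "(\<Sum>b<k. real (card \<Omega>) * ((real N)\<^sup>2 * \<mu>\<^sup>2 / 4) - 4 * (real N)\<^sup>2 * (\<Sum>w\<in>\<Omega>. B w b))
      \<le> (\<Sum>b<k. exp (2 * \<mu>\<^sup>2) * real N * (\<Sum>w\<in>\<Omega>. W w b))"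
    by (intro sum_mono) auto
  \<comment> \<open>The block sum moves inside because \<open>\<beta>\<close> and \<open>V\<close>
    bound totals over all blocks at one parameter.\<close>
  then have 2: "real k * (real (card \<Omega>) * ((real N)\<^sup>2 * \<mu>\<^sup>2 / 4)) - 4 * (real N)\<^sup>2 * (\<Sum>w\<in>\<Omega>. \<Sum>b<k. B w b)
      \<le> exp (2 * \<mu>\<^sup>2) * real N * (\<Sum>w\<in>\<Omega>. \<Sum>b<k. W w b)"
    by (subst (1 2) sum.swap) (simp add: sum_subtractf flip: sum_distrib_left)
  have 3: "(\<Sum>w\<in>\<Omega>. \<Sum>b<k. B w b) \<le> real (card \<Omega>) * \<beta>" "(\<Sum>w\<in>\<Omega>. \<Sum>b<k. W w b) \<le> real (card \<Omega>) * V"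
    using B_le W_le by (auto intro!: sum_bounded_above)
  have "(real (card \<Omega>) * real N) * (real N * (real k * \<mu>\<^sup>2 / 4 - 4 * \<beta>))
      = real k * (real (card \<Omega>) * ((real N)\<^sup>2 * \<mu>\<^sup>2 / 4)) - 4 * (real N)\<^sup>2 * (real (card \<Omega>) * \<beta>)"
    by (simp add: power2_eq_square algebra_simps)
  also have "\<dots> \<le> real k * (real (card \<Omega>) * ((real N)\<^sup>2 * \<mu>\<^sup>2 / 4)) - 4 * (real N)\<^sup>2 * (\<Sum>w\<in>\<Omega>. \<Sum>b<k. B w b)"
    using 3(1) by (intro diff_left_mono mult_left_mono) auto
  also note 2
  also have "exp (2 * \<mu>\<^sup>2) * real N * (\<Sum>w\<in>\<Omega>. \<Sum>b<k. W w b) \<le> exp (2 * \<mu>\<^sup>2) * real N * (real (card \<Omega>) * V)"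
    using 3(2) by (intro mult_left_mono) auto
  also have "\<dots> = (real (card \<Omega>) * real N) * (exp (2 * \<mu>\<^sup>2) * V)"
    by simp
  finally show ?thesis
    using \<Omega> N by (subst (asm) mult_le_cancel_left_pos) auto
qed

subsection \<open>Soft thresholding\<close>

lemma nn_integral_gauss_seq_component:
  assumes i: "i \<in> {1..n}" and [measurable]: "g \<in> borel_measurable borel"
  shows "(\<integral>\<^sup>+x. g (x i) \<partial>gauss_seq n \<theta>) = (\<integral>\<^sup>+y. g y \<partial>gauss (\<theta> i))"
proof -
  have "(\<integral>\<^sup>+y. g y \<partial>distr (gauss_seq n \<theta>) (gauss (\<theta> i)) (\<lambda>x. x i)) = (\<integral>\<^sup>+x. g (x i) \<partial>gauss_seq n \<theta>)"
    unfolding gauss_seq_def by (rule nn_integral_distr) (use i in simp_all)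
  then show ?thesis
    using distr_PiM_component[of "{1..n}" "\<lambda>i. gauss (\<theta> i)" i] i prob_space_gauss
    by (simp add: gauss_seq_def)
qed

lemma nn_integral_gauss_variance: "(\<integral>\<^sup>+x. ennreal ((x - a)\<^sup>2) \<partial>gauss a) = 1"
proof -
  have "(\<integral>\<^sup>+x. ennreal ((x - a)\<^sup>2) \<partial>gauss a) = (\<integral>\<^sup>+x. ennreal (normal_density a 1 x * (x - a)\<^sup>2) \<partial>lborel)"
    by (simp add: nn_integral_density ennreal_mult)
  also have "\<dots> = ennreal (\<integral>x. normal_density a 1 x * (x - a)\<^sup>2 \<partial>lborel)"
    by (intro nn_integral_eq_integral integrable_normal_moment) auto
  also have "(\<integral>x. normal_density a 1 x * (x - a)\<^sup>2 \<partial>lborel) = 1"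
    using integral_normal_moment_even[of 1 a 1] by (simp add: fact_numeral)
  finally show ?thesis by simp
qed

definition soft :: "real \<Rightarrow> real \<Rightarrow> real" where
  "soft \<tau> x = (if x > \<tau> then x - \<tau> else if x < - \<tau> then x + \<tau> else 0)"

lemma borel_measurable_soft [measurable]: "soft \<tau> \<in> borel_measurable borel"
  unfolding soft_def by measurable

lemma soft_lipschitz: "0 \<le> \<tau> \<Longrightarrow> \<bar>soft \<tau> x - soft \<tau> y\<bar> \<le> \<bar>x - y\<bar>"
  by (auto simp: soft_def)

lemma soft_close: "0 \<le> \<tau> \<Longrightarrow> \<bar>soft \<tau> x - x\<bar> \<le> \<tau>"
  by (auto simp: soft_def)

text \<open>Contraction: the deviation from \<open>soft \<tau> a\<close> is at most that of
  \<open>x\<close> from \<open>a\<close>, which has second moment 1. The centre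
  \<open>soft \<tau> a\<close> need not be the mean, but every centre gives an upper bound for the
  variance.\<close>

lemma nn_integral_soft_deviation:
  assumes "0 \<le> \<tau>"
  shows "(\<integral>\<^sup>+x. ennreal ((soft \<tau> x - soft \<tau> a)\<^sup>2) \<partial>gauss a) \<le> 1"
  unfolding nn_integral_gauss_variance[of a, symmetric]
  using soft_lipschitz[OF assms] by (intro nn_integral_mono ennreal_leI) (simp add: abs_le_square_iff)

text \<open>Thresholding moves \<open>x\<close> by at most \<open>\<tau>\<close>, and the square of
  a sum is at most twice the sum of the squares.\<close>

lemma nn_integral_soft_risk:
  assumes "0 \<le> \<tau>"
  shows "(\<integral>\<^sup>+x. ennreal ((soft \<tau> x - a)\<^sup>2) \<partial>gauss a) \<le> ennreal (2 + 2 * \<tau>\<^sup>2)"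
proof -
  interpret prob_space "gauss a" by (rule prob_space_gauss)
  have pt: "(soft \<tau> x - a)\<^sup>2 \<le> 2 * (x - a)\<^sup>2 + 2 * \<tau>\<^sup>2" for x
  proof -
    have "(soft \<tau> x - x)\<^sup>2 \<le> \<tau>\<^sup>2"
      using soft_close[OF assms, of x] assms by (simp add: abs_le_square_iff[symmetric])
    moreover have "2 * (x - a)\<^sup>2 + 2 * (soft \<tau> x - x)\<^sup>2 - (soft \<tau> x - a)\<^sup>2
        = ((x - a) - (soft \<tau> x - x))\<^sup>2"
      by (simp add: power2_eq_square algebra_simps)
    moreover have "0 \<le> ((x - a) - (soft \<tau> x - x))\<^sup>2" by simp
    ultimately show ?thesis by linarith
  qed
  have "(\<integral>\<^sup>+x. ennreal ((soft \<tau> x - a)\<^sup>2) \<partial>gauss a)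
      \<le> (\<integral>\<^sup>+x. ennreal (2 * (x - a)\<^sup>2) + ennreal (2 * \<tau>\<^sup>2) \<partial>gauss a)"
    using pt by (intro nn_integral_mono) (simp flip: ennreal_plus)
  also have "\<dots> = (\<integral>\<^sup>+x. 2 * ennreal ((x - a)\<^sup>2) \<partial>gauss a) + (\<integral>\<^sup>+x. ennreal (2 * \<tau>\<^sup>2) \<partial>gauss a)"
    by (subst nn_integral_add) (simp_all add: ennreal_mult)
  also have "\<dots> = 2 * 1 + ennreal (2 * \<tau>\<^sup>2)"
    using emeasure_space_1 by (subst nn_integral_cmult) (simp_all add: nn_integral_gauss_variance)
  also have "\<dots> = ennreal (2 + 2 * \<tau>\<^sup>2)"
    using ennreal_plus[of 2 "2 * \<tau>\<^sup>2"] by simp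
  finally show ?thesis .
qed

text \<open>Beyond the threshold the centred density is at most
  \<open>exp (- \<tau>\<^sup>2 / 2)\<close> times the density centred at the threshold. Each tail
  thus contributes at most that factor times a unit variance.\<close>

lemma nn_integral_soft_null:
  assumes "0 \<le> \<tau>"
  shows "(\<integral>\<^sup>+x. ennreal ((soft \<tau> x)\<^sup>2) \<partial>gauss 0) \<le> ennreal (2 * exp (- \<tau>\<^sup>2 / 2))"
proof -
  let ?e = "exp (- \<tau>\<^sup>2 / 2)"
  have shift: "normal_density 0 1 x \<le> ?e * normal_density b 1 x" if "b\<^sup>2 = \<tau>\<^sup>2" "b\<^sup>2 \<le> b * x" for b x
  proof -
    have "normal_density 0 1 x = exp (b\<^sup>2 / 2 - b * x) * normal_density b 1 x"
      by (simp add: normal_density_def power2_eq_square field_simps flip: exp_add)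
    also have "\<dots> \<le> ?e * normal_density b 1 x"
      using that by (intro mult_right_mono) auto
    finally show ?thesis .
  qed
  have pt: "normal_density 0 1 x * (soft \<tau> x)\<^sup>2
      \<le> ?e * (normal_density \<tau> 1 x * (x - \<tau>)\<^sup>2) + ?e * (normal_density (- \<tau>) 1 x * (x - - \<tau>)\<^sup>2)"
    (is "_ \<le> ?A + ?B") for x
  proof -
    have nn: "0 \<le> ?A" "0 \<le> ?B" by simp_all
    consider "x > \<tau>" | "x < - \<tau>" | "soft \<tau> x = 0"
      by (force simp: soft_def)
    then show ?thesis
    proof cases
      case 1
      then have "normal_density 0 1 x * (soft \<tau> x)\<^sup>2 \<le> (?e * normal_density \<tau> 1 x) * (x - \<tau>)\<^sup>2"
        using assms shift[of \<tau> x] mult_left_mono[of \<tau> x \<tau>]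
        by (auto simp: soft_def power2_eq_square intro!: mult_right_mono mult_left_mono)
      with nn show ?thesis unfolding mult.assoc by linarith
    next
      case 2
      then have "normal_density 0 1 x * (soft \<tau> x)\<^sup>2 \<le> (?e * normal_density (- \<tau>) 1 x) * (x - - \<tau>)\<^sup>2"
        using assms shift[of "- \<tau>" x] mult_left_mono[of "\<tau>" "- x" \<tau>]
        by (auto simp: soft_def power2_eq_square intro!: mult_right_mono)
      with nn show ?thesis unfolding mult.assoc by linarith
    next
      case 3
      then have "normal_density 0 1 x * (soft \<tau> x)\<^sup>2 = 0" by simp
      with nn show ?thesis by linarith
    qed
  qed
  have I: "(\<integral>\<^sup>+x. ennreal (?e * (normal_density b 1 x * (x - b)\<^sup>2)) \<partial>lborel) = ennreal ?e" for b
    using nn_integral_gauss_variance[of b]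
    by (simp add: nn_integral_density ennreal_mult nn_integral_cmult)
  have "(\<integral>\<^sup>+x. ennreal ((soft \<tau> x)\<^sup>2) \<partial>gauss 0)
      = (\<integral>\<^sup>+x. ennreal (normal_density 0 1 x * (soft \<tau> x)\<^sup>2) \<partial>lborel)"
    by (simp add: nn_integral_density ennreal_mult)
  also have "\<dots> \<le> (\<integral>\<^sup>+x. ennreal (?e * (normal_density \<tau> 1 x * (x - \<tau>)\<^sup>2))
      + ennreal (?e * (normal_density (- \<tau>) 1 x * (x - - \<tau>)\<^sup>2)) \<partial>lborel)"
    using pt by (intro nn_integral_mono) (simp flip: ennreal_plus)
  also have "\<dots> = ennreal ?e + ennreal ?e"
    by (subst nn_integral_add) (simp_all only: I, measurable)
  also have "\<dots> = ennreal (2 * ?e)"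
    by (simp flip: ennreal_plus)
  finally show ?thesis .
qed

text \<open>At most \<open>k\<close> components cost \<open>A\<close>, and the null components share
  a total budget of \<open>B\<close>.\<close>

lemma sum_sparse_le:
  assumes \<theta>: "\<theta> \<in> sparse_vectors n k" and "n \<ge> 1" and A: "0 \<le> A" and B: "0 \<le> B"
    and f: "\<And>i. i \<in> {1..n} \<Longrightarrow> f i \<le> ennreal (if \<theta> i = 0 then B / real n else A)"
  shows "(\<Sum>i\<in>{1..n}. f i) \<le> ennreal (real k * A + B)"
proof -
  have "(\<Sum>i\<in>{1..n}. f i) \<le> (\<Sum>i\<in>{1..n}. ennreal (if \<theta> i = 0 then B / real n else A))"
    using f by (rule sum_mono)
  also have "\<dots> = ennreal (\<Sum>i\<in>{1..n}. if \<theta> i = 0 then B / real n else A)"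
    using A B by (intro sum_ennreal) auto
  also have "(\<Sum>i\<in>{1..n}. if \<theta> i = 0 then B / real n else A)
      \<le> (\<Sum>i\<in>{1..n}. B / real n + (if \<theta> i \<noteq> 0 then A else 0))"
    using B by (intro sum_mono) auto
  also have "\<dots> = B + real (card {i \<in> {1..n}. \<theta> i \<noteq> 0}) * A"
    using \<open>n \<ge> 1\<close> by (simp add: sum.distrib flip: sum.inter_filter)
  also have "\<dots> \<le> real k * A + B"
    using \<theta> A by (simp add: sparse_vectors_def mult_right_mono)
  finally show ?thesis by (simp add: ennreal_leI)
qed

text \<open>The threshold is chosen so that \<open>exp (- \<tau>\<^sup>2 / 2)\<close> equals 1/n;
  the restriction keeps the values extensional.\<close>

definition soft_estimator :: "nat \<Rightarrow> (nat \<Rightarrow> real) \<Rightarrow> nat \<Rightarrow> real" where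
  "soft_estimator n x = (\<lambda>i\<in>{1..n}. soft (sqrt (2 * ln (real n))) (x i))"

lemma integrable_soft_estimator:
  assumes i: "i \<in> {1..n}"
  shows "integrable (gauss_seq n \<theta>) (\<lambda>x. soft_estimator n x i)"
proof -
  let ?\<tau> = "sqrt (2 * ln (real n))"
  interpret prob_space "gauss_seq n \<theta>" by (rule prob_space_gauss_seq)
  have [simp]: "0 \<le> ?\<tau>" using i by simp
  have [measurable]: "(\<lambda>x. soft ?\<tau> (x i)) \<in> borel_measurable (gauss_seq n \<theta>)"
    using i by measurable
  have "(\<integral>\<^sup>+x. ennreal ((soft ?\<tau> (x i) - \<theta> i)\<^sup>2) \<partial>gauss_seq n \<theta>)
      = (\<integral>\<^sup>+y. ennreal ((soft ?\<tau> y - \<theta> i)\<^sup>2) \<partial>gauss (\<theta> i))"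
    by (rule nn_integral_gauss_seq_component[OF i]) measurable
  also have "\<dots> \<le> ennreal (2 + 2 * ?\<tau>\<^sup>2)"
    using i by (intro nn_integral_soft_risk) simp
  also have "\<dots> < \<infinity>" by simp
  finally have "(\<integral>\<^sup>+x. ennreal ((soft ?\<tau> (x i) - \<theta> i)\<^sup>2) \<partial>gauss_seq n \<theta>) < \<infinity>" .
  then have "integrable (gauss_seq n \<theta>) (\<lambda>x. (soft ?\<tau> (x i) - \<theta> i)\<^sup>2)"
    by (intro integrableI_bounded) auto
  then have "integrable (gauss_seq n \<theta>) (\<lambda>x. soft ?\<tau> (x i) - \<theta> i)"
    by (rule square_integrable_imp_integrable[rotated]) measurable
  then have "integrable (gauss_seq n \<theta>) (\<lambda>x. soft ?\<tau> (x i) - \<theta> i + \<theta> i)"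
    by (rule Bochner_Integration.integrable_add) simp
  then show ?thesis
    using i by (simp add: soft_estimator_def)
qed

lemma risk_soft_estimator:
  assumes \<theta>: "\<theta> \<in> sparse_vectors n k" and n: "n \<ge> 1"
  shows "risk n \<theta> (soft_estimator n) \<le> ennreal (real k * (2 + 4 * ln (real n)) + 2)"
    and "(\<Sum>i\<in>{1..n}. coord_var n \<theta> (soft_estimator n) i) \<le> ennreal (real k + 2)"
proof -
  define \<tau> where "\<tau> = sqrt (2 * ln (real n))"
  interpret prob_space "gauss_seq n \<theta>" by (rule prob_space_gauss_seq)
  have \<tau>: "0 \<le> \<tau>" "\<tau>\<^sup>2 = 2 * ln (real n)" using n by (simp_all add: \<tau>_def)
  have null: "2 * exp (- \<tau>\<^sup>2 / 2) = 2 / real n"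
    unfolding \<tau>(2) using n by (simp add: exp_minus inverse_eq_divide)
  have comp: "(\<integral>\<^sup>+x. ennreal ((soft_estimator n x i - c)\<^sup>2) \<partial>gauss_seq n \<theta>)
      = (\<integral>\<^sup>+y. ennreal ((soft \<tau> y - c)\<^sup>2) \<partial>gauss (\<theta> i))" if "i \<in> {1..n}" for i c
    using nn_integral_gauss_seq_component[OF that, where g = "\<lambda>y. ennreal ((soft \<tau> y - c)\<^sup>2)"] that
    by (simp add: soft_estimator_def \<tau>_def)
  have null_le: "(\<integral>\<^sup>+x. ennreal ((soft_estimator n x i - 0)\<^sup>2) \<partial>gauss_seq n \<theta>) \<le> ennreal (2 / real n)"
    if "i \<in> {1..n}" "\<theta> i = 0" for i
    using nn_integral_soft_null[OF \<tau>(1)] that unfolding null comp[OF that(1)] by simp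
  \<comment> \<open>The mean minimises the second moment, so any centre may be used: 0 for null
    components and \<open>soft \<tau> (\<theta> i)\<close> for the others.\<close>
  have var_le: "coord_var n \<theta> (soft_estimator n) i
      \<le> (\<integral>\<^sup>+x. ennreal ((soft_estimator n x i - c)\<^sup>2) \<partial>gauss_seq n \<theta>)" if "i \<in> {1..n}" for i c
    using nn_second_moment_decomp[OF integrable_soft_estimator[OF that], of c]
    by (simp add: coord_var_def mean_def)
  have "risk n \<theta> (soft_estimator n)
      = (\<Sum>i\<in>{1..n}. \<integral>\<^sup>+x. ennreal ((soft_estimator n x i - \<theta> i)\<^sup>2) \<partial>gauss_seq n \<theta>)"
    by (intro risk_eq_sum integrable_soft_estimator)
  also have "\<dots> \<le> ennreal (real k * (2 + 4 * ln (real n)) + 2)"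
  proof (rule sum_sparse_le[OF \<theta> n])
    fix i assume i: "i \<in> {1..n}"
    show "(\<integral>\<^sup>+x. ennreal ((soft_estimator n x i - \<theta> i)\<^sup>2) \<partial>gauss_seq n \<theta>)
        \<le> ennreal (if \<theta> i = 0 then 2 / real n else 2 + 4 * ln (real n))"
    proof (cases "\<theta> i = 0")
      case True
      then show ?thesis using null_le[OF i True] by simp
    next
      case False
      then show ?thesis
        using nn_integral_soft_risk[OF \<tau>(1), of "\<theta> i"] by (simp add: comp[OF i] \<tau>(2))
    qed
  qed (use n in simp_all)
  finally show "risk n \<theta> (soft_estimator n) \<le> ennreal (real k * (2 + 4 * ln (real n)) + 2)" .
  have "(\<Sum>i\<in>{1..n}. coord_var n \<theta> (soft_estimator n) i) \<le> ennreal (real k * 1 + 2)"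
  proof (rule sum_sparse_le[OF \<theta> n])
    fix i assume i: "i \<in> {1..n}"
    show "coord_var n \<theta> (soft_estimator n) i \<le> ennreal (if \<theta> i = 0 then 2 / real n else 1)"
    proof (cases "\<theta> i = 0")
      case True
      then show ?thesis
        using order_trans[OF var_le[OF i] null_le[OF i True]] by simp
    next
      case False
      have "coord_var n \<theta> (soft_estimator n) i \<le> 1"
        using var_le[OF i, of "soft \<tau> (\<theta> i)"] nn_integral_soft_deviation[OF \<tau>(1), of "\<theta> i"]
        unfolding comp[OF i] by (rule order_trans)
      then show ?thesis using False by simp
    qed
  qed simp_all
  then show "(\<Sum>i\<in>{1..n}. coord_var n \<theta> (soft_estimator n) i) \<le> ennreal (real k + 2)"
    by simp
qed

lemma estimator_soft_estimator: "estimator s soft_estimator"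
proof -
  have "soft_estimator n \<in> (\<Pi>\<^sub>M i\<in>{1..n}. borel) \<rightarrow>\<^sub>M (\<Pi>\<^sub>M i\<in>{1..n}. borel)" for n
    unfolding soft_estimator_def by (intro measurable_restrict) measurable
  then show ?thesis
    by (auto simp: estimator_def intro: integrable_soft_estimator)
qed

lemma attains_rate_soft_estimator:
  assumes "\<forall>n\<ge>1. s n \<ge> 1"
  shows "attains_rate s soft_estimator"
  unfolding attains_rate_def lesssim_def
\<comment> \<open>8 = 2 + 4 + 2: once \<open>ln n \<ge> 1\<close>, which holds from n = 3 on, both
  constant contributions are at most \<open>2 * s n * ln n\<close>.\<close>
proof (intro exI[of _ 8] conjI)
  show "\<forall>\<^sub>F n in sequentially. worst_risk s soft_estimator n \<le> ennreal 8 * sparse_rate s n"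
    using eventually_ge_at_top[of 3]
  proof eventually_elim
    case (elim n)
    have "exp 1 \<le> real n" using exp_le elim by linarith
    then have ln: "1 \<le> ln (real n)" using elim by (simp add: ln_ge_iff)
    have s: "1 \<le> real (s n)" using assms elim by (metis One_nat_def le_trans numeral_3_eq_3 of_nat_1 of_nat_mono le_SucI order_refl)
    have "2 * real (s n) \<le> 2 * real (s n) * ln (real n)" "1 \<le> real (s n) * ln (real n)"
      using ln s mult_mono[OF s ln] by simp_all
    then have *: "real (s n) * (2 + 4 * ln (real n)) + 2 \<le> 8 * (real (s n) * ln (real n))"
      by (simp add: algebra_simps)
    have "worst_risk s soft_estimator n \<le> ennreal (8 * (real (s n) * ln (real n)))"
      unfolding worst_risk_def using elim
      by (intro SUP_least order_trans[OF risk_soft_estimator(1) ennreal_leI[OF *]]) auto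
    then show ?case
      using ln by (simp add: sparse_rate_def ennreal_mult)
  qed
qed simp

lemma worst_var_soft_estimator:
  assumes "\<forall>n\<ge>1. s n \<ge> 1"
  shows "lesssim (worst_var s soft_estimator) (\<lambda>n. ennreal (real (s n)))"
  unfolding lesssim_def
proof (intro exI[of _ 3] conjI)
  show "\<forall>\<^sub>F n in sequentially. worst_var s soft_estimator n \<le> ennreal 3 * ennreal (real (s n))"
    using eventually_ge_at_top[of 1]
  proof eventually_elim
    case (elim n)
    then have *: "real (s n) + 2 \<le> 3 * real (s n)"
      using assms by (simp add: Suc_leI)
    have "worst_var s soft_estimator n \<le> ennreal (3 * real (s n))"
      unfolding worst_var_def using elim
      by (intro SUP_least order_trans[OF risk_soft_estimator(2) ennreal_leI[OF *]])
    then show ?case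
      by (simp add: ennreal_mult)
  qed
qed simp

subsection \<open>Asymptotics\<close>

lemma real_div_nat_ge: "real a / real b - 1 \<le> real (a div b)"
proof (cases "b = 0")
  case False
  have "a < b * (a div b) + b"
    using False by (metis add_strict_left_mono bot_nat_0.not_eq_extremum mod_less_divisor mult_div_mod_eq)
  then have "real a < real b * real (a div b) + real b"
    by (metis of_nat_add of_nat_less_iff of_nat_mult)
  then show ?thesis using False by (simp add: field_simps)
qed simp

text \<open>Supplies the block length \<open>n div s n\<close> for \<open>spike_tradeoff\<close>.
  Eventually \<open>s n\<close> is at most half of the root of n, so the exact quotient is at least
  twice that root, and rounding down loses at most 1.\<close>

lemma eventually_sparse:
  fixes s :: "nat \<Rightarrow> nat"
  assumes s_pos: "\<forall>n\<ge>1. s n \<ge> 1"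
    and s_sparse: "(\<lambda>n. real (s n) / sqrt (real n)) \<longlonglongrightarrow> 0"
  shows "\<forall>\<^sub>F n in sequentially. s n \<le> n \<and> 2 \<le> n div s n \<and> sqrt (real n) \<le> real (n div s n)"
proof -
  have "\<forall>\<^sub>F n in sequentially. real (s n) / sqrt (real n) < 1 / 2"
    using s_sparse by (rule order_tendstoD) simp
  then show ?thesis
    using eventually_ge_at_top[of 4]
  proof eventually_elim
    case (elim n)
    have s: "1 \<le> s n" using s_pos elim by simp
    have "sqrt 4 \<le> sqrt (real n)" using elim by (intro real_sqrt_le_mono) simp
    then have root: "2 \<le> sqrt (real n)" by simp
    have s2: "2 * real (s n) \<le> sqrt (real n)" using elim by (simp add: field_simps)
    then have "2 * real (s n) * sqrt (real n) \<le> sqrt (real n) * sqrt (real n)"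
      by (rule mult_right_mono) simp
    then have "2 * sqrt (real n) \<le> real n / real (s n)"
      using s by (simp add: field_simps)
    with real_div_nat_ge[of n "s n"] root have N: "sqrt (real n) \<le> real (n div s n)"
      by linarith
    with root have "2 \<le> real (n div s n)" by linarith
    moreover from this have "s n \<le> n"
      by (metis div_less linorder_not_le not_numeral_le_zero of_nat_0)
    ultimately show ?case using N by simp
  qed
qed

lemma sq_bias_le_risk:
  assumes "\<And>i. i \<in> {1..n} \<Longrightarrow> integrable (gauss_seq n \<theta>) (\<lambda>x. t x i)"
  shows "sq_bias n \<theta> t \<le> risk n \<theta> t"
  using bias_variance_decomposition[of n \<theta> t] assms by simp

lemma sum_coord_var_le_risk:
  assumes "\<And>i. i \<in> {1..n} \<Longrightarrow> integrable (gauss_seq n \<theta>) (\<lambda>x. t x i)"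
  shows "(\<Sum>i\<in>{1..n}. coord_var n \<theta> t i) \<le> risk n \<theta> t"
  using bias_variance_decomposition[of n \<theta> t] assms by simp

lemma estimator_integrable:
  assumes "estimator s T" "n \<ge> 1" "\<theta> \<in> sparse_vectors n (s n)" "i \<in> {1..n}"
  shows "integrable (gauss_seq n \<theta>) (\<lambda>x. T n x i)"
  using assms by (simp add: estimator_def)

lemma worst_sq_bias_le_worst_risk:
  assumes "estimator s T" "n \<ge> 1"
  shows "worst_sq_bias s T n \<le> worst_risk s T n"
  unfolding worst_sq_bias_def worst_risk_def
proof (rule SUP_mono)
  fix \<theta> assume \<theta>: "\<theta> \<in> sparse_vectors n (s n)"
  have "sq_bias n \<theta> (T n) \<le> risk n \<theta> (T n)"
    by (rule sq_bias_le_risk) (rule estimator_integrable[OF assms \<theta>])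
  with \<theta> show "\<exists>\<eta>\<in>sparse_vectors n (s n). sq_bias n \<theta> (T n) \<le> risk n \<eta> (T n)"
    by blast
qed

section \<open>Lower bounds for estimators attaining the rate\<close>

lemma worst_var_ge:
  fixes s :: "nat \<Rightarrow> nat"
  assumes s_pos: "\<forall>n\<ge>1. s n \<ge> 1"
    and s_sparse: "(\<lambda>n. real (s n) / sqrt (real n)) \<longlonglongrightarrow> 0"
    and T: "estimator s T" and rate: "attains_rate s T"
  shows "\<forall>\<^sub>F n in sequentially. worst_var s T n \<ge> ennreal (real (s n) / 2)"
proof -
  obtain C where "C > 0" and C: "\<forall>\<^sub>F n in sequentially. worst_risk s T n \<le> ennreal C * sparse_rate s n"
    using rate unfolding attains_rate_def lesssim_def by blast
  show ?thesis
    using C eventually_sparse[OF s_pos s_sparse] eventually_ge_at_top[of 1]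
  proof eventually_elim
    case (elim n)
    \<comment> \<open>The squared bias is at most the risk, hence at most \<open>D\<^sup>2\<close>,
      a finite bound for this \<open>n\<close>.\<close>
    define D where "D = sqrt (C * (real (s n) * ln (real n)))"
    have D: "0 \<le> D" "D\<^sup>2 = C * (real (s n) * ln (real n))"
      using \<open>C > 0\<close> elim by (simp_all add: D_def)
    show ?case
      unfolding worst_var_def
    proof (rule worst_variance_ge_half[where D = D])
      fix \<theta> assume \<theta>: "\<theta> \<in> sparse_vectors n (s n)"
      then have "sq_bias n \<theta> (T n) \<le> worst_sq_bias s T n"
        unfolding worst_sq_bias_def by (rule SUP_upper)
      also have "\<dots> \<le> worst_risk s T n"
        using T elim by (intro worst_sq_bias_le_worst_risk)
      also have "\<dots> \<le> ennreal (D\<^sup>2)"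
        using elim \<open>C > 0\<close> by (simp add: D(2) sparse_rate_def ennreal_mult)
      finally show "sq_bias n \<theta> (T n) \<le> ennreal (D\<^sup>2)" .
    qed (use elim D T in \<open>auto intro: estimator_integrable\<close>)
  qed
qed

lemma sparse_rate_lesssim_worst_sq_bias:
  fixes s :: "nat \<Rightarrow> nat"
  assumes s_pos: "\<forall>n\<ge>1. s n \<ge> 1"
    and s_sparse: "(\<lambda>n. real (s n) / sqrt (real n)) \<longlonglongrightarrow> 0"
    and T: "estimator s T" and rate: "attains_rate s T"
  shows "lesssim (sparse_rate s) (worst_sq_bias s T)"
  unfolding lesssim_def
proof (intro exI[of _ 512] conjI)
  obtain C where "C > 0" and C: "\<forall>\<^sub>F n in sequentially. worst_risk s T n \<le> ennreal C * sparse_rate s n"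
    using rate unfolding attains_rate_def lesssim_def by blast
  have "(\<lambda>n. real n powr (- (3 / 8))) \<longlonglongrightarrow> 0"
    by (rule tendsto_neg_powr[OF _ filterlim_real_sequentially]) simp
  \<comment> \<open>This keeps the variance term below \<open>R / 128\<close>, half of the main term
    \<open>R / 64\<close>. The other half is then at most \<open>4 * \<beta>\<close>, whence the
    constant 512.\<close>
  then have small: "\<forall>\<^sub>F n in sequentially. real n powr (- (3 / 8)) < 1 / (128 * C)"
    using \<open>C > 0\<close> by (intro order_tendstoD(2)) auto
  show "\<forall>\<^sub>F n in sequentially. sparse_rate s n \<le> ennreal 512 * worst_sq_bias s T n"
    using C small eventually_sparse[OF s_pos s_sparse] eventually_ge_at_top[of 1]
  proof eventually_elim
    case (elim n)
    define R where "R = real (s n) * ln (real n)"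
    have R: "0 \<le> R" using elim by (simp add: R_def)
    have risk: "worst_risk s T n \<le> ennreal (C * R)"
      using elim R \<open>C > 0\<close> by (simp add: R_def sparse_rate_def ennreal_mult)
    have "worst_sq_bias s T n \<le> ennreal (C * R)"
      using worst_sq_bias_le_worst_risk[OF T, of n] elim risk by (meson order_trans)
    then obtain \<beta> where \<beta>: "worst_sq_bias s T n = ennreal \<beta>" "0 \<le> \<beta>"
      by (cases "worst_sq_bias s T n") (auto simp: top_unique)
    \<comment> \<open>With this height \<open>exp (2 * \<mu>\<^sup>2)\<close> is n to the power 1/8,
      smaller than the block length by at least the factor n to the power 3/8, while
      \<open>s n * \<mu>\<^sup>2 / 4\<close> is still \<open>R / 64\<close>.\<close>
    define \<mu> where "\<mu> = sqrt (ln (real n)) / 4"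
    have \<mu>: "\<mu>\<^sup>2 = ln (real n) / 16"
      using elim by (simp add: \<mu>_def power_divide)
    have "real (n div s n) * (real (s n) * \<mu>\<^sup>2 / 4 - 4 * \<beta>) \<le> exp (2 * \<mu>\<^sup>2) * (C * R)"
    proof (rule spike_tradeoff)
      fix \<theta> assume \<theta>: "\<theta> \<in> sparse_vectors n (s n)"
      show "sq_bias n \<theta> (T n) \<le> ennreal \<beta>"
        unfolding \<beta>(1)[symmetric] worst_sq_bias_def using \<theta> by (rule SUP_upper)
      have "(\<Sum>i\<in>{1..n}. coord_var n \<theta> (T n) i) \<le> risk n \<theta> (T n)"
        using T elim \<theta> by (intro sum_coord_var_le_risk estimator_integrable) auto
      also have "\<dots> \<le> worst_risk s T n"
        unfolding worst_risk_def using \<theta> by (rule SUP_upper)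
      finally show "(\<Sum>i\<in>{1..n}. coord_var n \<theta> (T n) i) \<le> ennreal (C * R)"
        using risk by (rule order_trans)
    qed (use elim \<beta> R T \<open>C > 0\<close> in \<open>auto intro: estimator_integrable\<close>)
    moreover have "exp (2 * \<mu>\<^sup>2) = sqrt (real n) * real n powr (- (3 / 8))"
    proof -
      have "exp (2 * \<mu>\<^sup>2) = real n powr (1 / 2 + - (3 / 8))"
        using elim by (simp add: \<mu> powr_def)
      also have "\<dots> = sqrt (real n) * real n powr (- (3 / 8))"
        by (subst powr_add) (simp add: powr_half_sqrt)
      finally show ?thesis .
    qed
    ultimately have main: "real (n div s n) * (R / 64 - 4 * \<beta>)
        \<le> sqrt (real n) * (real n powr (- (3 / 8)) * (C * R))"
      by (simp add: \<mu> R_def mult.assoc)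
    \<comment> \<open>The block length may be replaced by the smaller root of n only if the bracket
      is nonnegative; otherwise the bound is immediate.\<close>
    have "R / 64 - 4 * \<beta> \<le> real n powr (- (3 / 8)) * (C * R)"
    proof (cases "0 \<le> R / 64 - 4 * \<beta>")
      case True
      then have "sqrt (real n) * (R / 64 - 4 * \<beta>) \<le> real (n div s n) * (R / 64 - 4 * \<beta>)"
        using elim by (intro mult_right_mono) auto
      also note main
      finally show ?thesis
        using elim by (subst (asm) mult_le_cancel_left_pos) auto
    next
      case False
      moreover have "0 \<le> real n powr (- (3 / 8)) * (C * R)"
        using R \<open>C > 0\<close> by simp
      ultimately show ?thesis by linarith
    qed
    also have "\<dots> \<le> 1 / (128 * C) * (C * R)"
      using elim R \<open>C > 0\<close> by (intro mult_right_mono) auto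
    also have "\<dots> = R / 128"
      using \<open>C > 0\<close> by simp
    finally have "R \<le> 512 * \<beta>" by simp
    then have "ennreal R \<le> ennreal (512 * \<beta>)"
      by (rule ennreal_leI)
    then show ?case
      using \<beta> by (simp add: sparse_rate_def R_def ennreal_mult)
  qed
qed simp

theorem theorem6p1:
  fixes s :: "nat \<Rightarrow> nat"
  assumes s_pos: "\<forall>n\<ge>1. s n \<ge> 1"
    and s_sparse: "(\<lambda>n. real (s n) / sqrt (real n)) \<longlonglongrightarrow> 0"
  shows "(\<forall>T. estimator s T \<and> attains_rate s T \<longrightarrow>
            same_order (worst_sq_bias s T) (sparse_rate s) \<and>
            (\<forall>\<^sub>F n in sequentially. worst_var s T n \<ge> ennreal (real (s n) / 2)))
       \<and> (\<forall>\<delta>::real. 0 < \<delta> \<and> \<delta> < 1/2 \<and>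
              (\<forall>n\<ge>1. real (s n) \<le> real n powr (1/2 - \<delta>)) \<longrightarrow>
            (\<exists>T. estimator s T \<and> attains_rate s T \<and>
              lesssim (worst_var s T) (\<lambda>n. ennreal (real (s n)))))"
proof (intro conjI allI impI; (elim conjE)?)
  fix T assume T: "estimator s T" and rate: "attains_rate s T"
  obtain C where "C > 0" and C: "\<forall>\<^sub>F n in sequentially. worst_risk s T n \<le> ennreal C * sparse_rate s n"
    using rate unfolding attains_rate_def lesssim_def by blast
  \<comment> \<open>Upper half of the order relation: the squared bias is part of the risk.\<close>
  have "\<forall>\<^sub>F n in sequentially. worst_sq_bias s T n \<le> ennreal C * sparse_rate s n"
    using C eventually_ge_at_top[of 1]
    by eventually_elim (use worst_sq_bias_le_worst_risk[OF T] order_trans in blast)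
  then have "lesssim (worst_sq_bias s T) (sparse_rate s)"
    unfolding lesssim_def using \<open>C > 0\<close> by blast
  then show "same_order (worst_sq_bias s T) (sparse_rate s)"
    unfolding same_order_def using sparse_rate_lesssim_worst_sq_bias[OF s_pos s_sparse T rate] by blast
  show "\<forall>\<^sub>F n in sequentially. worst_var s T n \<ge> ennreal (real (s n) / 2)"
    by (rule worst_var_ge[OF s_pos s_sparse T rate])
next
  show "\<exists>T. estimator s T \<and> attains_rate s T \<and> lesssim (worst_var s T) (\<lambda>n. ennreal (real (s n)))"
    using estimator_soft_estimator attains_rate_soft_estimator[OF s_pos] worst_var_soft_estimator[OF s_pos]
    by blast
qed

end
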